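(* Let $h\ge 2$ and let $T_h$ be the complete binary tree of height $h$. Every layout of $T_h$ of \textsc{MinEP} type attains the minimum value of the weighted edge product $\bar\ell_0$ over all Recursive Layouts of $T_h$ with cut height $g=1$.
   Context: The complete binary tree $T_h$ of height $h$ has levels $0,\dots,h-1$ (the root is on level $0$, level $d$ has $2^d$ nodes), hence $2^h-1$ nodes. A layout is a bijection $\pi$ from the nodes to $\{1,\dots,2^h-1\}$. For an edge $e=uv$ its length is $\ell_e=|\pi(u)-\pi(v)|$. If $e$ joins a node on level $d-1$ to a node on level $d$, its weight is $w_e=2^{-d}$. Let $W=\sum_e w_e$. The weighted edge product is $\bar\ell_0=\bigl(\prod_e \ell_e^{\,w_e}\bigr)^{1/W}=\exp\bigl(\frac1W\sum_e w_e\log\ell_e\bigr)$. For a node $v$, let $T_v$ denote the subtree consisting of $v$ and all its descendants. A Recursive Layout with cut height $1$ is a layout $\pi$ satisfying the following conditions. First, for every node $v$ the set $\pi(T_v)$ is a contiguous interval of integers. Second, every node $v$ with children, i.e. every $v$ for which $T_v$ has height at least $2$, has one of two types: - in-order type: $\pi(v)$ lies strictly between the intervals occupied by its two child subtrees; - pre-order type: $\pi(v)$ is an endpoint of the interval $\pi(T_v)$, so both child subtrees lie on the same side of $\pi(v)$. This type covers both pre-order and post-order placement. Either child subtree may be placed on either side. The layout is further constrained as follows: (i) if $v$ is not the root and has pre-order type, then $\pi(v)$ is the endpoint of $\pi(T_v)$ nearer to $\pi(\mathrm{parent}(v))$; (ii) if $v$ has pre-order type, both of its children have children, and the child subtree whose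 interval is adjacent to $\pi(v)$ has a root of in-order type, then the root of the other child subtree also has in-order type. A \textsc{MinEP}-type layout is a Recursive Layout with cut height $1$ satisfying three rules: - the root has in-order type; - every node of in-order type has both children (when they have children) of pre-order type; - every node $v$ of pre-order type has its child subtree adjacent to $\pi(v)$ rooted at a node of pre-order type, and its other child subtree rooted at a node of in-order type (whenever these children have children). *)

theory Defs
  imports Complex_Main "HOL-Library.Sublist"
begin

(* A node of the complete binary tree is the path leading to it from the root:
   [] is the root, the children of v are v @ [False] and v @ [True], the level of v
   is length v, and the descendants of v (v included) are its extensions. The two
   truth values only name the children; they carry no left/right information. *)

type_synonym node = "bool list"

definition nodes :: "nat \<Rightarrow> node set" where
  "nodes h = {v. length v < h}"

definition internal :: "nat \<Rightarrow> node \<Rightarrow> bool" where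
  "internal h v \<longleftrightarrow> length v + 1 < h"

definition subtree :: "nat \<Rightarrow> node \<Rightarrow> node set" where
  "subtree h v = {u \<in> nodes h. prefix v u}"

definition edges :: "nat \<Rightarrow> (node \<times> node) set" where
  "edges h = {(u, u @ [b]) | u b. internal h u}"

definition layout :: "nat \<Rightarrow> (node \<Rightarrow> int) \<Rightarrow> bool" where
  "layout h \<pi> \<longleftrightarrow> bij_betw \<pi> (nodes h) {1..2 ^ h - 1}"

definition edge_length :: "(node \<Rightarrow> int) \<Rightarrow> node \<times> node \<Rightarrow> real" where
  "edge_length \<pi> e = real_of_int \<bar>\<pi> (fst e) - \<pi> (snd e)\<bar>"

definition edge_weight :: "node \<times> node \<Rightarrow> real" where
  "edge_weight e = (1 / 2) ^ length (snd e)"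

definition total_weight :: "nat \<Rightarrow> real" where
  "total_weight h = (\<Sum>e\<in>edges h. edge_weight e)"

definition weighted_edge_product :: "nat \<Rightarrow> (node \<Rightarrow> int) \<Rightarrow> real" where
  "weighted_edge_product h \<pi> =
     (\<Prod>e\<in>edges h. edge_length \<pi> e powr edge_weight e) powr (1 / total_weight h)"

definition in_order_type :: "nat \<Rightarrow> (node \<Rightarrow> int) \<Rightarrow> node \<Rightarrow> bool" where
  "in_order_type h \<pi> v \<longleftrightarrow> internal h v \<and>
     (\<exists>b. (\<forall>x \<in> subtree h (v @ [b]). \<pi> x < \<pi> v) \<and>
          (\<forall>y \<in> subtree h (v @ [\<not> b]). \<pi> v < \<pi> y))"

definition endpoints :: "nat \<Rightarrow> (node \<Rightarrow> int) \<Rightarrow> node \<Rightarrow> int set" where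
  "endpoints h \<pi> v = {Min (\<pi> ` subtree h v), Max (\<pi> ` subtree h v)}"

definition pre_order_type :: "nat \<Rightarrow> (node \<Rightarrow> int) \<Rightarrow> node \<Rightarrow> bool" where
  "pre_order_type h \<pi> v \<longleftrightarrow> internal h v \<and> \<pi> v \<in> endpoints h \<pi> v"

definition adjacent_subtree :: "nat \<Rightarrow> (node \<Rightarrow> int) \<Rightarrow> node \<Rightarrow> node \<Rightarrow> bool" where
  "adjacent_subtree h \<pi> v c \<longleftrightarrow> (\<exists>x \<in> subtree h c. \<bar>\<pi> x - \<pi> v\<bar> = 1)"

(* The parent of a non-root node v is butlast v. *)

definition recursive_layout :: "nat \<Rightarrow> (node \<Rightarrow> int) \<Rightarrow> bool" where
  "recursive_layout h \<pi> \<longleftrightarrow>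
     layout h \<pi> \<and>
     (\<forall>v \<in> nodes h. \<exists>a b. \<pi> ` subtree h v = {a..b}) \<and>
     (\<forall>v \<in> nodes h. internal h v \<longrightarrow> in_order_type h \<pi> v \<or> pre_order_type h \<pi> v) \<and>
     (\<forall>v \<in> nodes h. v \<noteq> [] \<and> pre_order_type h \<pi> v \<longrightarrow>
        (\<forall>e \<in> endpoints h \<pi> v. \<bar>\<pi> v - \<pi> (butlast v)\<bar> \<le> \<bar>e - \<pi> (butlast v)\<bar>)) \<and>
     (\<forall>v \<in> nodes h. \<forall>b. pre_order_type h \<pi> v \<and>
        internal h (v @ [b]) \<and> internal h (v @ [\<not> b]) \<and>
        adjacent_subtree h \<pi> v (v @ [b]) \<and> in_order_type h \<pi> (v @ [b]) \<longrightarrow>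
        in_order_type h \<pi> (v @ [\<not> b]))"

definition minEP_layout :: "nat \<Rightarrow> (node \<Rightarrow> int) \<Rightarrow> bool" where
  "minEP_layout h \<pi> \<longleftrightarrow>
     recursive_layout h \<pi> \<and>
     in_order_type h \<pi> [] \<and>
     (\<forall>v \<in> nodes h. in_order_type h \<pi> v \<longrightarrow>
        (\<forall>b. internal h (v @ [b]) \<longrightarrow> pre_order_type h \<pi> (v @ [b]))) \<and>
     (\<forall>v \<in> nodes h. \<forall>b. pre_order_type h \<pi> v \<and> adjacent_subtree h \<pi> v (v @ [b]) \<longrightarrow>
        (internal h (v @ [b]) \<longrightarrow> pre_order_type h \<pi> (v @ [b])) \<and>
        (internal h (v @ [\<not> b]) \<longrightarrow> in_order_type h \<pi> (v @ [\<not> b])))"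

end

theory Submission
  imports Defs
begin

text \<open>
  Let \<open>C\<close> be the weighted sum of the logarithms of the edge lengths below a node, rescaled so
  that the edges to its children have weight \<open>1/2\<close>. In a recursive layout, the length of an edge
  depends only on the type of its child and on the gap between the parent and the interval of
  the child. Hence the minimal values of \<open>C\<close> for in-order and for pre-order nodes satisfy a
  joint recursion on the height, and the three rules of a MinEP layout choose the smaller
  alternative in every step of it. That they do is a two-sided estimate of the difference
  \<open>D\<close> of the two values, which satisfies
  \<open>D (m + 1) = (ln (3 * 2 ^ m - 1) - D m) / 2\<close>.
\<close>

section \<open>Optimal values for the two types\<close>

text \<open>The index counts the levels below the node, so 0 is a leaf. The clauses hard-wire the
  MinEP choices: a pre-order child at distance 1 adds ln 1 = 0, while the far child is in-order,
  with \<open>2 ^ Suc m\<close> steps to its interval and \<open>2 ^ m - 1\<close> more to the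
  middle of it, together \<open>3 * 2 ^ m - 1\<close>.\<close>

fun opt_in :: "nat \<Rightarrow> real" and opt_pre :: "nat \<Rightarrow> real" where
  "opt_in 0 = 0"
| "opt_in (Suc m) = opt_pre m"
| "opt_pre 0 = 0"
| "opt_pre (Suc m) = (opt_pre m + opt_in m + ln (3 * 2 ^ m - 1)) / 2"

text \<open>Induction step for \<open>D = opt_pre m - opt_in m\<close> with
  \<open>x = 2 ^ m\<close>. As \<open>D\<close> enters \<open>D'\<close> with a minus sign, its
  upper bound yields both lower bounds on \<open>D'\<close>, and its lower bound yields the upper
  one.\<close>

lemma opt_difference_step:
  fixes x D :: real
  assumes x: "x \<ge> 1" and D: "0 \<le> D" "D \<le> ln x"
  defines "D' \<equiv> (ln (3 * x - 1) - D) / 2"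
  shows "0 \<le> D'" "D' \<le> ln (2 * x)" "ln (6 * x - 1) - ln (4 * x) \<le> D'"
proof -
  have "ln x \<le> ln (3 * x - 1)"
    using x by simp
  then show "0 \<le> D'"
    using D by (simp add: D'_def)
  have xx: "x \<le> x * x"
    using x by (simp add: mult_le_cancel_left1)
  have "3 * x - 1 \<le> (2 * x) * (2 * x)"
    using x xx by linarith
  then have "ln (3 * x - 1) \<le> ln ((2 * x) * (2 * x))"
    using x by (subst ln_le_cancel_iff) auto
  also have "\<dots> = 2 * ln (2 * x)"
    using x ln_mult_pos[of "2 * x" "2 * x"] by simp
  finally show "D' \<le> ln (2 * x)"
    using D by (simp add: D'_def)
  \<comment> \<open>Replacing \<open>D\<close> by its bound \<open>ln x\<close> and doubling turns
    the last claim into this inequality, which no longer contains \<open>D\<close>.\<close>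
  have "ln ((6 * x - 1) * (6 * x - 1) * x) \<le> ln ((4 * x) * (4 * x) * (3 * x - 1))"
  proof (subst ln_le_cancel_iff)
    have "(6 * x - 1) * (6 * x - 1) \<le> 16 * x * (3 * x - 1)"
    proof -
      have "16 * x * (3 * x - 1) - (6 * x - 1) * (6 * x - 1) = 12 * (x * x) - 4 * x - 1"
        by (simp add: algebra_simps)
      then show ?thesis
        using x xx by linarith
    qed
    then have "(6 * x - 1) * (6 * x - 1) * x \<le> 16 * x * (3 * x - 1) * x"
      by (rule mult_right_mono) (use x in simp)
    then show "(6 * x - 1) * (6 * x - 1) * x \<le> (4 * x) * (4 * x) * (3 * x - 1)"
      by (simp add: algebra_simps)
  qed (use x in auto)
  moreover have "ln (p * p * q) = 2 * ln p + ln q" if "p > 0" "q > 0" for p q :: real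
    using that by (simp add: ln_mult_pos)
  ultimately have "2 * ln (6 * x - 1) + ln x \<le> 2 * ln (4 * x) + ln (3 * x - 1)"
    using x by (simp only:)
  then show "ln (6 * x - 1) - ln (4 * x) \<le> D'"
    using D by (simp add: D'_def)
qed

text \<open>One comparison per choice of type: for the root; for a child at gap 1, whose edge has
  length 1 if pre-order and \<open>2 ^ m\<close> if in-order; for a child at gap
  \<open>2 ^ Suc m\<close>, whose edge has length \<open>2 ^ Suc m\<close> if pre-order and
  \<open>3 * 2 ^ m - 1\<close> if in-order.\<close>

lemma opt_bounds:
  "opt_in m \<le> opt_pre m"
  "opt_pre m \<le> opt_in m + ln (2 ^ m)"
  "opt_in m + ln (3 * 2 ^ m - 1) \<le> opt_pre m + ln (2 ^ Suc m)"
proof -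
  have "0 \<le> opt_pre m - opt_in m \<and> opt_pre m - opt_in m \<le> ln (2 ^ m) \<and>
      ln (3 * 2 ^ m - 1) - ln (2 ^ Suc m) \<le> opt_pre m - opt_in m"
  proof (induction m)
    case 0
    show ?case by simp
  next
    case (Suc m)
    define D where "D = opt_pre m - opt_in m"
    have D': "opt_pre (Suc m) - opt_in (Suc m) = (ln (3 * 2 ^ m - 1) - D) / 2"
      by (simp add: D_def field_simps)
    have "0 \<le> D" "D \<le> ln (2 ^ m)"
      using Suc.IH by (simp_all add: D_def)
    then show ?case
      using opt_difference_step[of "2 ^ m" D] unfolding D' by simp
  qed
  then show "opt_in m \<le> opt_pre m" "opt_pre m \<le> opt_in m + ln (2 ^ m)"
    "opt_in m + ln (3 * 2 ^ m - 1) \<le> opt_pre m + ln (2 ^ Suc m)"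
    by linarith+
qed

section \<open>The weighted edge product as a recursive cost\<close>

text \<open>Halving once per level makes the weights relative to \<open>v\<close>, so the recursion
  has the same form at every node. At the root with \<open>m = h - 1\<close> this is the sum of w_e
  ln l_e.\<close>

fun log_cost :: "(node \<Rightarrow> int) \<Rightarrow> nat \<Rightarrow> node \<Rightarrow> real" where
  "log_cost \<pi> 0 v = 0"
| "log_cost \<pi> (Suc m) v =
     (\<Sum>b\<in>UNIV. log_cost \<pi> m (v @ [b]) + ln (edge_length \<pi> (v, v @ [b]))) / 2"

lemma finite_length_less: "finite {w :: bool list. length w < n}"
  using finite_lists_length_le[of "UNIV :: bool set" n]
  by (rule rev_finite_subset) auto

lemma log_cost_eq_sum:
  "log_cost \<pi> m v = (\<Sum>w | length w < m.
     (1 / 2) ^ Suc (length w) * (\<Sum>b\<in>UNIV. ln (edge_length \<pi> (v @ w, v @ w @ [b]))))"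
proof (induction m arbitrary: v)
  case 0
  show ?case by simp
next
  case (Suc m)
  define g where "g w = (1 / 2) ^ Suc (length w) *
    (\<Sum>b\<in>UNIV. ln (edge_length \<pi> (v @ w, v @ w @ [b])))" for w
  \<comment> \<open>Paths are split at their first step because \<open>log_cost\<close> descends
    through the children of \<open>v\<close>.\<close>
  have split: "{w. length w < Suc m} = insert [] ((\<lambda>(b, w). b # w) ` (UNIV \<times> {w. length w < m}))"
    by (auto simp: image_iff length_Suc_conv less_Suc_eq_0_disj)
  have inj: "inj_on (\<lambda>(b, w). b # w) A" for A :: "(bool \<times> bool list) set"
    by (auto simp: inj_on_def)
  have "(\<Sum>w | length w < Suc m. g w) = g [] + (\<Sum>(b, w)\<in>UNIV \<times> {w. length w < m}. g (b # w))"
    unfolding split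
    by (subst sum.insert, force simp: finite_length_less, force, subst sum.reindex[OF inj])
      (simp add: case_prod_unfold)
  also have "\<dots> = g [] + (\<Sum>b\<in>UNIV. \<Sum>w | length w < m. g (b # w))"
    by (simp add: sum.cartesian_product)
  also have "\<dots> = g [] + (\<Sum>b\<in>UNIV. log_cost \<pi> m (v @ [b]) / 2)"
    unfolding Suc.IH by (simp add: g_def sum_divide_distrib)
  also have "\<dots> = log_cost \<pi> (Suc m) v"
    by (simp add: g_def sum.distrib sum_divide_distrib add_divide_distrib)
  finally show ?case
    by (simp add: g_def)
qed

lemma edge_length_pos:
  assumes "layout h \<pi>" "internal h v"
  shows "edge_length \<pi> (v, v @ [b]) > 0"
proof -
  have "inj_on \<pi> (nodes h)" "v \<in> nodes h" "v @ [b] \<in> nodes h"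
    using assms by (auto simp: layout_def bij_betw_def nodes_def internal_def)
  then have "\<pi> v \<noteq> \<pi> (v @ [b])"
    by (auto dest: inj_onD)
  then show ?thesis
    by (simp add: edge_length_def)
qed

text \<open>The outer exponent is the same for all layouts, so comparing products reduces to
  comparing \<open>log_cost\<close> at the root.\<close>

lemma weighted_edge_product_eq:
  assumes "layout h \<pi>" "h = Suc m"
  shows "weighted_edge_product h \<pi> = exp (log_cost \<pi> m []) powr (1 / total_weight h)"
proof -
  let ?E = "{u :: node. length u < m} \<times> (UNIV :: bool set)"
  have edges: "edges h = (\<lambda>(u, b). (u, u @ [b])) ` ?E"
    using assms(2) by (auto simp: edges_def internal_def)
  have inj: "inj_on (\<lambda>(u :: node, b). (u, u @ [b])) ?E"
    by (auto simp: inj_on_def)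
  have "(\<Prod>e\<in>edges h. edge_length \<pi> e powr edge_weight e) =
      (\<Prod>(u, b)\<in>?E. edge_length \<pi> (u, u @ [b]) powr edge_weight (u, u @ [b]))"
    unfolding edges prod.reindex[OF inj] by (simp add: case_prod_unfold)
  also have "\<dots> = (\<Prod>(u, b)\<in>?E. exp ((1 / 2) ^ Suc (length u) * ln (edge_length \<pi> (u, u @ [b]))))"
  proof (intro prod.cong refl, clarsimp)
    fix u :: node and b
    assume "length u < m"
    \<comment> \<open>At base 0 \<open>powr\<close> has the value 0; only a nonzero base permits the
      exponential form.\<close>
    then have "edge_length \<pi> (u, u @ [b]) > 0"
      using assms by (intro edge_length_pos) (auto simp: internal_def)
    then show "edge_length \<pi> (u, u @ [b]) powr edge_weight (u, u @ [b]) =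
        exp ((1 / 2) ^ length u * ln (edge_length \<pi> (u, u @ [b])) / 2)"
      by (simp add: powr_def edge_weight_def)
  qed
  also have "\<dots> = exp (\<Sum>(u, b)\<in>?E. (1 / 2) ^ Suc (length u) * ln (edge_length \<pi> (u, u @ [b])))"
    by (subst exp_sum) (auto simp: finite_length_less case_prod_unfold)
  also have "(\<Sum>(u, b)\<in>?E. (1 / 2) ^ Suc (length u) * ln (edge_length \<pi> (u, u @ [b]))) =
      log_cost \<pi> m []"
    unfolding log_cost_eq_sum sum.cartesian_product[symmetric] sum_distrib_left by simp
  finally show ?thesis
    by (simp add: weighted_edge_product_def)
qed

section \<open>Edge lengths in recursive layouts\<close>

lemma subtree_split:
  assumes "internal h v"
  shows "subtree h v = insert v (subtree h (v @ [b]) \<union> subtree h (v @ [\<not> b]))"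
proof (intro set_eqI iffI)
  fix u
  assume "u \<in> subtree h v"
  then obtain w where u: "u = v @ w" "length u < h"
    by (auto simp: subtree_def nodes_def prefix_def)
  show "u \<in> insert v (subtree h (v @ [b]) \<union> subtree h (v @ [\<not> b]))"
    using u by (cases w) (auto simp: subtree_def nodes_def prefix_def)
next
  fix u
  assume "u \<in> insert v (subtree h (v @ [b]) \<union> subtree h (v @ [\<not> b]))"
  then show "u \<in> subtree h v"
    using assms by (auto simp: subtree_def nodes_def internal_def prefix_def)
qed

lemma children_disjoint:
  "v \<notin> subtree h (v @ [b])" "subtree h (v @ [b]) \<inter> subtree h (v @ [\<not> b]) = {}"
  by (auto simp: subtree_def prefix_def)

lemma subtree_subset_nodes: "subtree h v \<subseteq> nodes h"
  by (auto simp: subtree_def)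

lemma self_in_subtree: "v \<in> nodes h \<Longrightarrow> v \<in> subtree h v"
  by (simp add: subtree_def)

lemma finite_subtree: "finite (subtree h v)"
  using finite_length_less[of h] by (simp add: subtree_def nodes_def)

lemma card_subtree:
  assumes "length v + k = h"
  shows "card (subtree h v) = 2 ^ k - 1"
  using assms
proof (induction k arbitrary: v)
  case 0
  then have "subtree h v = {}"
    by (auto simp: subtree_def nodes_def prefix_def)
  then show ?case by simp
next
  case (Suc k)
  show ?case
  \<comment> \<open>For \<open>k = 0\<close> the node is a leaf, to which
    \<open>subtree_split\<close> does not apply.\<close>
  proof (cases "k = 0")
    case True
    then have "subtree h v = {v}"
      using Suc.prems by (auto simp: subtree_def nodes_def prefix_def)
    then show ?thesis using True by simp
  next
    case False
    then have "internal h v"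
      using Suc.prems by (simp add: internal_def)
    then have "card (subtree h v) =
        Suc (card (subtree h (v @ [True]) \<union> subtree h (v @ [\<not> True])))"
      using children_disjoint(1)[of v h] by (subst subtree_split[of h v True]) (auto simp: finite_subtree)
    also have "\<dots> = Suc ((2 ^ k - 1) + (2 ^ k - 1))"
      using Suc.prems children_disjoint(2)[of h v True]
      by (subst card_Un_disjoint) (auto simp: finite_subtree Suc.IH)
    finally show ?thesis
      using one_le_power[of "2::nat" k] unfolding power_Suc by linarith
  qed
qed

section \<open>Intervals occupied by subtrees\<close>

context
  fixes h :: nat and \<pi> :: "node \<Rightarrow> int"
  assumes rec: "recursive_layout h \<pi>"
begin

lemma card_image_subtree:
  assumes "length v + k = h"
  shows "int (card (\<pi> ` subtree h v)) = 2 ^ k - 1"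
proof -
  have "inj_on \<pi> (nodes h)"
    using rec by (simp add: recursive_layout_def layout_def bij_betw_def)
  then have "inj_on \<pi> (subtree h v)"
    by (rule inj_on_subset) (rule subtree_subset_nodes)
  then show ?thesis
    using assms by (simp add: card_image card_subtree of_nat_diff)
qed

lemma image_subtree_interval:
  assumes "length v + Suc m = h"
  obtains a where "\<pi> ` subtree h v = {a..a + 2 ^ Suc m - 2}"
proof -
  have v: "v \<in> nodes h"
    using assms by (simp add: nodes_def)
  have "\<forall>v\<in>nodes h. \<exists>a b. \<pi> ` subtree h v = {a..b}"
    using rec by (simp add: recursive_layout_def)
  with v obtain a b where ab: "\<pi> ` subtree h v = {a..b}"
    by blast
  \<comment> \<open>The cardinality of an interval determines its upper end only if the interval is
    nonempty.\<close>
  moreover have "a \<le> b"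
    using imageI[OF self_in_subtree[OF v], of \<pi>] unfolding ab by simp
  ultimately have "b = a + 2 ^ Suc m - 2"
    using card_image_subtree[OF assms] by simp
  with ab that show thesis by simp
qed

lemma image_children_disjoint:
  assumes "internal h v"
  shows "\<pi> v \<notin> \<pi> ` subtree h (v @ [b])"
    "\<pi> ` subtree h (v @ [b]) \<inter> \<pi> ` subtree h (v @ [\<not> b]) = {}"
proof -
  have inj: "inj_on \<pi> (nodes h)"
    using rec by (simp add: recursive_layout_def layout_def bij_betw_def)
  have "v \<in> nodes h"
    using assms by (simp add: nodes_def internal_def)
  then show "\<pi> v \<notin> \<pi> ` subtree h (v @ [b])"
    using inj children_disjoint(1)[of v h b] subtree_subset_nodes
    by (auto dest!: inj_onD)
  show "\<pi> ` subtree h (v @ [b]) \<inter> \<pi> ` subtree h (v @ [\<not> b]) = {}"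
    using children_disjoint(2)[of h v b]
    by (subst inj_on_image_Int[OF inj, symmetric]) (auto simp: subtree_subset_nodes)
qed

lemma in_order_children_images:
  assumes "in_order_type h \<pi> v" "\<pi> ` subtree h v = {a..e}"
  obtains b where "\<pi> ` subtree h (v @ [b]) = {a..<\<pi> v}"
    "\<pi> ` subtree h (v @ [\<not> b]) = {\<pi> v<..e}"
proof -
  from assms obtain b where b: "\<forall>x \<in> subtree h (v @ [b]). \<pi> x < \<pi> v"
      "\<forall>y \<in> subtree h (v @ [\<not> b]). \<pi> v < \<pi> y" and int: "internal h v"
    by (auto simp: in_order_type_def)
  \<comment> \<open>The two images fill the interval apart from \<open>\<pi> v\<close> and lie on
    opposite sides of it, so each is everything on its side.\<close>
  have "{a..e} = insert (\<pi> v) (\<pi> ` subtree h (v @ [b]) \<union> \<pi> ` subtree h (v @ [\<not> b]))"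
    using subtree_split[OF int, of b] assms(2) by auto
  moreover have "\<pi> ` subtree h (v @ [b]) \<subseteq> {..<\<pi> v}" "\<pi> ` subtree h (v @ [\<not> b]) \<subseteq> {\<pi> v<..}"
    using b by auto
  ultimately have "\<pi> ` subtree h (v @ [b]) = {a..e} \<inter> {..<\<pi> v}"
      "\<pi> ` subtree h (v @ [\<not> b]) = {a..e} \<inter> {\<pi> v<..}" "\<pi> v \<in> {a..e}"
    by fastforce+
  then have "\<pi> ` subtree h (v @ [b]) = {a..<\<pi> v}" "\<pi> ` subtree h (v @ [\<not> b]) = {\<pi> v<..e}"
    by auto
  with that show thesis by blast
qed

text \<open>The two child subtrees have equal size, so an in-order node sits exactly in the middle,
  whichever child is lower.\<close>

lemma in_order_position:
  assumes "in_order_type h \<pi> v" "length v + Suc m = h" "\<pi> ` subtree h v = {a..e}"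
  shows "\<pi> v = a + 2 ^ m - 1"
proof -
  obtain b where b: "\<pi> ` subtree h (v @ [b]) = {a..<\<pi> v}"
    using in_order_children_images[OF assms(1,3)] by metis
  have "\<pi> v \<in> {a..e}"
    using assms(2,3) self_in_subtree[of v h] by (auto simp: nodes_def)
  then show ?thesis
    using card_image_subtree[of "v @ [b]" m] b assms(2) by simp
qed

lemma endpoints_eq:
  assumes "\<pi> ` subtree h v = {a..e}" "a \<le> e"
  shows "endpoints h \<pi> v = {a, e}"
proof -
  have "Min {a..e} = a" "Max {a..e} = e"
    using assms(2) by (auto intro: Min_eqI Max_eqI)
  then show ?thesis
    by (simp add: endpoints_def assms(1))
qed

end

section \<open>Edge length from the type of the child and its gap to the parent\<close>

text \<open>For positive \<open>d\<close> this is the distance from the parent to the near end of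
  the child's interval; gap 1 means adjacency. The disjunction merges the two mirror images, which
  give equal edge lengths.\<close>

definition gap :: "nat \<Rightarrow> (node \<Rightarrow> int) \<Rightarrow> node \<Rightarrow> bool \<Rightarrow> int \<Rightarrow> bool" where
  "gap h \<pi> v b d \<longleftrightarrow> (\<exists>a e. \<pi> ` subtree h (v @ [b]) = {a..e} \<and> a \<le> e \<and> (\<pi> v = a - d \<or> \<pi> v = e + d))"

text \<open>Leaves count as having both types: the edge lengths for the two types agree at height 1.\<close>

definition in_like :: "nat \<Rightarrow> (node \<Rightarrow> int) \<Rightarrow> node \<Rightarrow> bool" where
  "in_like h \<pi> v \<longleftrightarrow> (internal h v \<longrightarrow> in_order_type h \<pi> v)"

definition pre_like :: "nat \<Rightarrow> (node \<Rightarrow> int) \<Rightarrow> node \<Rightarrow> bool" where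
  "pre_like h \<pi> v \<longleftrightarrow> (internal h v \<longrightarrow> pre_order_type h \<pi> v)"

context
  fixes h :: nat and \<pi> :: "node \<Rightarrow> int"
  assumes rec: "recursive_layout h \<pi>"
begin

lemma in_like_or_pre_like: "v \<in> nodes h \<Longrightarrow> in_like h \<pi> v \<or> pre_like h \<pi> v"
  using rec by (simp add: in_like_def pre_like_def recursive_layout_def)

lemma edge_length_pre_like:
  assumes "length v + Suc (Suc m) = h" "gap h \<pi> v b d" "d \<ge> 1" "pre_like h \<pi> (v @ [b])"
  shows "edge_length \<pi> (v, v @ [b]) = real_of_int d"
proof -
  obtain a e where ae: "\<pi> ` subtree h (v @ [b]) = {a..e}" "a \<le> e" "\<pi> v = a - d \<or> \<pi> v = e + d"
    using assms(2) by (auto simp: gap_def)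
  have n: "v @ [b] \<in> nodes h"
    using assms(1) by (simp add: nodes_def)
  have "\<bar>\<pi> v - \<pi> (v @ [b])\<bar> = d"
  proof (cases "internal h (v @ [b])")
    case True
    then have pre: "pre_order_type h \<pi> (v @ [b])"
      using assms(4) by (simp add: pre_like_def)
    then have "\<pi> (v @ [b]) \<in> {a, e}"
      using endpoints_eq[OF rec ae(1,2)] by (simp add: pre_order_type_def)
    \<comment> \<open>This is constraint (i): the child takes the end of its interval nearer to
      \<open>v\<close>, and that end is \<open>d\<close> away.\<close>
    moreover have "\<forall>x\<in>{a, e}. \<bar>\<pi> (v @ [b]) - \<pi> v\<bar> \<le> \<bar>x - \<pi> v\<bar>"
      using rec n pre endpoints_eq[OF rec ae(1,2)]
      unfolding recursive_layout_def by (metis butlast_snoc snoc_eq_iff_butlast)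
    ultimately show ?thesis
      using ae(2,3) assms(3) by auto
  next
    case False
    then have "int (card {a..e}) = 1"
      using card_image_subtree[OF rec, of "v @ [b]" 1] assms(1) ae(1) by (simp add: internal_def)
    then have "a = e"
      using ae(2) by simp
    moreover have "\<pi> (v @ [b]) \<in> {a..e}"
      using self_in_subtree[OF n] ae(1) by auto
    ultimately show ?thesis
      using ae(3) assms(3) by auto
  qed
  then show ?thesis
    by (simp add: edge_length_def)
qed

text \<open>The middle of \<open>2 ^ Suc m - 1\<close> positions is \<open>2 ^ m - 1\<close> steps
  from either end, on top of the gap. For a leaf these extra steps are 0.\<close>

lemma edge_length_in_like:
  assumes "length v + Suc (Suc m) = h" "gap h \<pi> v b d" "d \<ge> 1" "in_like h \<pi> (v @ [b])"
  shows "edge_length \<pi> (v, v @ [b]) = real_of_int (d + 2 ^ m - 1)"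
proof (cases "internal h (v @ [b])")
  case True
  obtain a e where ae: "\<pi> ` subtree h (v @ [b]) = {a..e}" "a \<le> e" "\<pi> v = a - d \<or> \<pi> v = e + d"
    using assms(2) by (auto simp: gap_def)
  have "\<pi> (v @ [b]) = a + 2 ^ m - 1"
    using in_order_position[OF rec _ _ ae(1)] True assms(1,4) by (simp add: in_like_def)
  moreover have "e = a + 2 ^ Suc m - 2"
    using card_image_subtree[OF rec, of "v @ [b]" "Suc m"] assms(1) ae(1,2) by simp
  moreover have "(1::int) \<le> 2 ^ m" by simp
  ultimately have "\<bar>\<pi> v - \<pi> (v @ [b])\<bar> = d + 2 ^ m - 1"
    using ae(3) assms(3) unfolding power_Suc by linarith
  then show ?thesis
    by (simp add: edge_length_def)
next
  case False
  then have "m = 0" "pre_like h \<pi> (v @ [b])"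
    using assms(1) by (auto simp: internal_def pre_like_def)
  then show ?thesis
    using edge_length_pre_like[OF assms(1,2,3)] by simp
qed

lemma gap_in_order:
  assumes "length v + Suc (Suc m) = h" "in_order_type h \<pi> v"
  shows "gap h \<pi> v b 1"
proof -
  obtain a where a: "\<pi> ` subtree h v = {a..a + 2 ^ Suc (Suc m) - 2}"
    using image_subtree_interval[OF rec, of v "Suc m"] assms(1) by auto
  obtain c where c: "\<pi> ` subtree h (v @ [c]) = {a..<\<pi> v}"
      "\<pi> ` subtree h (v @ [\<not> c]) = {\<pi> v<..a + 2 ^ Suc (Suc m) - 2}"
    using in_order_children_images[OF rec assms(2) a] by metis
  have pos: "\<pi> v = a + 2 ^ Suc m - 1"
    using in_order_position[OF rec assms(2) _ a, of "Suc m"] assms(1) by simp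
  have p: "(1::int) \<le> 2 ^ m" by simp
  consider "b = c" | "b = (\<not> c)" by blast
  then show ?thesis
  proof cases
    case 1
    show ?thesis
      unfolding gap_def using 1 c(1) pos p
      by (intro exI[of _ a] exI[of _ "\<pi> v - 1"]) (auto simp: atLeastLessThanPlusOne_atLeastAtMost_int)
  next
    case 2
    have "{\<pi> v<..a + 2 ^ Suc (Suc m) - 2} = {\<pi> v + 1..a + 2 ^ Suc (Suc m) - 2}"
      by auto
    then show ?thesis
      unfolding gap_def using 2 c(2) pos p
      by (intro exI[of _ "\<pi> v + 1"] exI[of _ "a + 2 ^ Suc (Suc m) - 2"]) auto
  qed
qed

text \<open>With \<open>v\<close> at one end, the rest of its interval is two disjoint blocks of
  \<open>2 ^ Suc m - 1\<close> positions, one behind the other. The near block touches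
  \<open>v\<close>; the far one begins one step beyond it.\<close>

lemma gap_pre_order:
  assumes "length v + Suc (Suc m) = h" "pre_order_type h \<pi> v"
  obtains b where "adjacent_subtree h \<pi> v (v @ [b])" "gap h \<pi> v b 1" "gap h \<pi> v (\<not> b) (2 ^ Suc m)"
proof -
  define N :: int where "N = 2 ^ Suc m - 1"
  have N: "N \<ge> 1"
    using one_le_power[of "2::int" m] unfolding N_def power_Suc by linarith
  have int: "internal h v"
    using assms(2) by (simp add: pre_order_type_def)
  obtain a where a: "\<pi> ` subtree h v = {a..a + 2 * N}"
    using image_subtree_interval[OF rec, of v "Suc m"] assms(1)
    by (auto simp: N_def algebra_simps)
  have child: "\<exists>x. \<pi> ` subtree h (v @ [b]) = {x..x + N - 1}" for b
  proof -
    obtain x where "\<pi> ` subtree h (v @ [b]) = {x..x + 2 ^ Suc m - 2}"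
      using image_subtree_interval[OF rec, of "v @ [b]" m] assms(1) by auto
    then show ?thesis
      by (intro exI[of _ x]) (simp add: N_def algebra_simps)
  qed
  obtain x y where x: "\<pi> ` subtree h (v @ [True]) = {x..x + N - 1}"
    and y: "\<pi> ` subtree h (v @ [False]) = {y..y + N - 1}"
    using child[of True] child[of False] by blast
  have un: "{a..a + 2 * N} = insert (\<pi> v) ({x..x + N - 1} \<union> {y..y + N - 1})"
    unfolding a[symmetric] x[symmetric] y[symmetric] subtree_split[OF int, of True]
    by (simp add: image_Un)
  have disj: "{x..x + N - 1} \<inter> {y..y + N - 1} = {}"
    using image_children_disjoint(2)[OF rec int, of True] x y by simp
  have out: "\<pi> v \<notin> {x..x + N - 1}" "\<pi> v \<notin> {y..y + N - 1}"
    using image_children_disjoint(1)[OF rec int, of True]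
      image_children_disjoint(1)[OF rec int, of False] x y by simp_all
  have order: "x + N \<le> y \<or> y + N \<le> x"
  proof (rule ccontr)
    assume "\<not> ?thesis"
    \<comment> \<open>Of two overlapping blocks of equal size, the later starting point lies in
      both.\<close>
    then have "max x y \<in> {x..x + N - 1} \<inter> {y..y + N - 1}"
      by auto
    with disj show False by blast
  qed
  \<comment> \<open>Testing the ends of the blocks turns the set equation into linear
    bounds.\<close>
  have mem: "z \<in> {a..a + 2 * N}" if "z \<in> {x, x + N - 1, y, y + N - 1}" for z
    unfolding un using that N by auto
  have bounds: "a \<le> x" "x + N - 1 \<le> a + 2 * N" "a \<le> y" "y + N - 1 \<le> a + 2 * N"
    using mem[of x] mem[of "x + N - 1"] mem[of y] mem[of "y + N - 1"] by auto
  have "\<pi> v = a \<or> \<pi> v = a + 2 * N"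
    using assms(2) endpoints_eq[OF rec a] N by (simp add: pre_order_type_def)
  moreover have "\<pi> v < x \<or> x + N \<le> \<pi> v" "\<pi> v < y \<or> y + N \<le> \<pi> v"
    using out by auto
  \<comment> \<open>Four cases: \<open>v\<close> below or above its descendants, and either child
    the near one. The total \<open>2 * N + 1\<close> leaves no free position, so the bounds force
    equalities.\<close>
  ultimately have pos: "\<pi> v = x - 1 \<and> \<pi> v = y - (N + 1) \<or> \<pi> v = y - 1 \<and> \<pi> v = x - (N + 1) \<or>
      \<pi> v = y + N \<and> \<pi> v = x + N - 1 + (N + 1) \<or> \<pi> v = x + N \<and> \<pi> v = y + N - 1 + (N + 1)"
    using order bounds N by (elim disjE) (simp_all only: , linarith+)
  have gapI: "gap h \<pi> v b d"
    if "\<pi> ` subtree h (v @ [b]) = {z..z + N - 1}" "\<pi> v = z - d \<or> \<pi> v = z + N - 1 + d" for b z d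
    unfolding gap_def using that N by (intro exI[of _ z] exI[of _ "z + N - 1"]) auto
  have adjI: "adjacent_subtree h \<pi> v (v @ [b])"
    if "\<pi> ` subtree h (v @ [b]) = {z..z + N - 1}" "\<pi> v = z - 1 \<or> \<pi> v = z + N" for b z
  proof -
    have "\<exists>t\<in>\<pi> ` subtree h (v @ [b]). \<bar>t - \<pi> v\<bar> = 1"
      unfolding that(1) using that(2)
    proof
      assume "\<pi> v = z - 1"
      then show "\<exists>t\<in>{z..z + N - 1}. \<bar>t - \<pi> v\<bar> = 1"
        using N by (intro bexI[of _ z]) auto
    next
      assume "\<pi> v = z + N"
      then show "\<exists>t\<in>{z..z + N - 1}. \<bar>t - \<pi> v\<bar> = 1"
        using N by (intro bexI[of _ "z + N - 1"]) auto
    qed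
    then show ?thesis
      by (auto simp: adjacent_subtree_def)
  qed
  have N1: "2 ^ Suc m = N + 1"
    by (simp add: N_def)
  from pos consider
      "\<pi> v = x - 1 \<or> \<pi> v = x + N" "\<pi> v = y - (N + 1) \<or> \<pi> v = y + N - 1 + (N + 1)"
    | "\<pi> v = y - 1 \<or> \<pi> v = y + N" "\<pi> v = x - (N + 1) \<or> \<pi> v = x + N - 1 + (N + 1)"
    by blast
  then show thesis
  proof cases
    case 1
    have "gap h \<pi> v True 1"
      by (rule gapI[OF x]) (use 1(1) in simp)
    moreover have "gap h \<pi> v (\<not> True) (2 ^ Suc m)"
      unfolding N1 not_True_eq_False by (rule gapI[OF y 1(2)])
    ultimately show thesis
      by (rule that[OF adjI[OF x 1(1)]])
  next
    case 2
    have "gap h \<pi> v False 1"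
      by (rule gapI[OF y]) (use 2(1) in simp)
    moreover have "gap h \<pi> v (\<not> False) (2 ^ Suc m)"
      unfolding N1 not_False_eq_True by (rule gapI[OF x 2(2)])
    ultimately show thesis
      by (rule that[OF adjI[OF y 2(1)]])
  qed
qed

section \<open>Optimality\<close>

text \<open>A pre-order child adds ln 1 = 0; an in-order child adds \<open>ln (2 ^ m)\<close>, which
  outweighs its smaller optimum by \<open>opt_bounds(2)\<close>. The last two premises are the
  induction hypotheses for the child.\<close>

lemma near_child_cost:
  assumes "length v + Suc (Suc m) = h" "gap h \<pi> v b 1"
    and "in_like h \<pi> (v @ [b]) \<Longrightarrow> opt_in m \<le> log_cost \<pi> m (v @ [b])"
    and "pre_like h \<pi> (v @ [b]) \<Longrightarrow> opt_pre m \<le> log_cost \<pi> m (v @ [b])"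
  shows "opt_pre m \<le> log_cost \<pi> m (v @ [b]) + ln (edge_length \<pi> (v, v @ [b]))"
proof -
  have "v @ [b] \<in> nodes h"
    using assms(1) by (simp add: nodes_def)
  then consider "in_like h \<pi> (v @ [b])" | "pre_like h \<pi> (v @ [b])"
    using in_like_or_pre_like by blast
  then show ?thesis
  proof cases
    case 1
    then show ?thesis
      using edge_length_in_like[OF assms(1,2)] assms(3) opt_bounds(2)[of m] by simp
  next
    case 2
    then show ?thesis
      using edge_length_pre_like[OF assms(1,2)] assms(4) by simp
  qed
qed

text \<open>Here the in-order child meets the bound directly, and \<open>opt_bounds(3)\<close> shows
  that the shorter edge of a pre-order child does not make up for its larger optimum.\<close>

lemma far_child_cost:
  assumes "length v + Suc (Suc m) = h" "gap h \<pi> v b (2 ^ Suc m)"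
    and "in_like h \<pi> (v @ [b]) \<Longrightarrow> opt_in m \<le> log_cost \<pi> m (v @ [b])"
    and "pre_like h \<pi> (v @ [b]) \<Longrightarrow> opt_pre m \<le> log_cost \<pi> m (v @ [b])"
  shows "opt_in m + ln (3 * 2 ^ m - 1) \<le> log_cost \<pi> m (v @ [b]) + ln (edge_length \<pi> (v, v @ [b]))"
proof -
  have d: "(1::int) \<le> 2 ^ Suc m"
    by (rule one_le_power) simp
  have "v @ [b] \<in> nodes h"
    using assms(1) by (simp add: nodes_def)
  then consider "in_like h \<pi> (v @ [b])" | "pre_like h \<pi> (v @ [b])"
    using in_like_or_pre_like by blast
  then show ?thesis
  proof cases
    case 1
    then show ?thesis
      using edge_length_in_like[OF assms(1,2) d] assms(3) by simp
  next
    case 2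
    then show ?thesis
      using edge_length_pre_like[OF assms(1,2) d] assms(4) opt_bounds(3)[of m] by simp
  qed
qed

lemma sum_bool: "(\<Sum>c\<in>UNIV. f c) = f b + f (\<not> b)" for f :: "bool \<Rightarrow> real"
  by (cases b) (auto simp: UNIV_bool)

text \<open>Both types go through one induction since each recursion refers to children of either
  type. An in-order node has two near children, a pre-order node one near and one far.\<close>

lemma opt_le_log_cost:
  assumes "length v + Suc m = h"
  shows "in_like h \<pi> v \<Longrightarrow> opt_in m \<le> log_cost \<pi> m v"
    and "pre_like h \<pi> v \<Longrightarrow> opt_pre m \<le> log_cost \<pi> m v"
  using assms
proof (induction m arbitrary: v)
  case 0
  case 1 show ?case by simp
next
  case 0
  case 2 show ?case by simp
next
  case (Suc m)
  {
    case 1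
    have int: "in_order_type h \<pi> v"
      using 1 by (auto simp: in_like_def internal_def)
    have "opt_pre m \<le> log_cost \<pi> m (v @ [b]) + ln (edge_length \<pi> (v, v @ [b]))" for b
      using 1 gap_in_order[OF _ int] Suc.IH[of "v @ [b]"] by (intro near_child_cost) auto
    from this[of True] this[of False] show ?case
      by (simp add: sum_bool[of _ True])
  next
    case 2
    have pre: "pre_order_type h \<pi> v"
      using 2 by (auto simp: pre_like_def internal_def)
    obtain b where b: "gap h \<pi> v b 1" "gap h \<pi> v (\<not> b) (2 ^ Suc m)"
      using gap_pre_order[OF 2(2) pre] by metis
    have "opt_pre m \<le> log_cost \<pi> m (v @ [b]) + ln (edge_length \<pi> (v, v @ [b]))"
      using 2 b Suc.IH[of "v @ [b]"] by (intro near_child_cost) auto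
    moreover have "opt_in m + ln (3 * 2 ^ m - 1) \<le>
        log_cost \<pi> m (v @ [\<not> b]) + ln (edge_length \<pi> (v, v @ [\<not> b]))"
      using 2 b Suc.IH[of "v @ [\<not> b]"] by (intro far_child_cost) auto
    ultimately show ?case
      by (simp add: sum_bool[of _ b])
  }
qed

section \<open>Attainment by MinEP layouts\<close>

text \<open>The same induction with equalities: the MinEP rules give each child the type for which
  the near or far bound is exact.\<close>

lemma log_cost_minEP:
  assumes "length v + Suc m = h" and minEP: "minEP_layout h \<pi>"
  shows "in_like h \<pi> v \<Longrightarrow> log_cost \<pi> m v = opt_in m"
    and "pre_like h \<pi> v \<Longrightarrow> log_cost \<pi> m v = opt_pre m"
  using assms(1)
proof (induction m arbitrary: v)
  case 0
  case 1 show ?case by simp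
next
  case 0
  case 2 show ?case by simp
next
  case (Suc m)
  {
    case 1
    have int: "in_order_type h \<pi> v" and v: "v \<in> nodes h"
      using 1 by (auto simp: in_like_def internal_def nodes_def)
    have pre: "pre_like h \<pi> (v @ [b])" for b
      using minEP int v by (auto simp: pre_like_def minEP_layout_def)
    have "log_cost \<pi> m (v @ [b]) + ln (edge_length \<pi> (v, v @ [b])) = opt_pre m" for b
      using edge_length_pre_like[OF 1(2) gap_in_order[OF 1(2) int] _ pre] Suc.IH(2)[OF pre] 1 by simp
    then show ?case
      by simp
  next
    case 2
    have pre: "pre_order_type h \<pi> v" and v: "v \<in> nodes h"
      using 2 by (auto simp: pre_like_def internal_def nodes_def)
    obtain b where b: "adjacent_subtree h \<pi> v (v @ [b])"
        "gap h \<pi> v b 1" "gap h \<pi> v (\<not> b) (2 ^ Suc m)"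
      using gap_pre_order[OF 2(2) pre] by metis
    have d: "(1::int) \<le> 2 ^ Suc m"
      by (rule one_le_power) simp
    have near: "pre_like h \<pi> (v @ [b])" and far: "in_like h \<pi> (v @ [\<not> b])"
      using minEP pre v b(1) unfolding pre_like_def in_like_def minEP_layout_def by blast+
    have "log_cost \<pi> m (v @ [b]) + ln (edge_length \<pi> (v, v @ [b])) = opt_pre m"
      using edge_length_pre_like[OF 2(2) b(2) _ near] Suc.IH(2)[OF near] 2 by simp
    moreover have "log_cost \<pi> m (v @ [\<not> b]) + ln (edge_length \<pi> (v, v @ [\<not> b])) =
        opt_in m + ln (3 * 2 ^ m - 1)"
      using edge_length_in_like[OF 2(2) b(3) d far] Suc.IH(1)[OF far] 2 by simp
    ultimately show ?case
      by (simp add: sum_bool[of _ b])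
  }
qed

end

theorem theorem3:
  fixes h :: nat and \<pi> :: "node \<Rightarrow> int"
  assumes "h \<ge> 2"
    and "minEP_layout h \<pi>"
  shows "is_arg_min (weighted_edge_product h) (recursive_layout h) \<pi>"
proof -
  obtain m where m: "h = Suc m"
    using assms(1) by (cases h) auto
  have rec: "recursive_layout h \<pi>"
    using assms(2) by (simp add: minEP_layout_def)
  have opt: "log_cost \<pi> m [] = opt_in m"
    using log_cost_minEP(1)[OF rec _ assms(2), of "[]" m] assms(2) m
    by (simp add: minEP_layout_def in_like_def)
  have "weighted_edge_product h \<pi> \<le> weighted_edge_product h \<rho>" if \<rho>: "recursive_layout h \<rho>" for \<rho>
  proof -
    \<comment> \<open>The competing layout may have a pre-order root; \<open>opt_bounds(1)\<close>
      covers that case.\<close>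
    have "opt_in m \<le> log_cost \<rho> m []"
      using opt_le_log_cost[OF \<rho>, of "[]" m] in_like_or_pre_like[OF \<rho>, of "[]"] opt_bounds(1)[of m] m
      by (auto simp: nodes_def)
    \<comment> \<open>A nonnegative exponent makes the outer \<open>powr\<close> monotone.\<close>
    moreover have "total_weight h \<ge> 0"
      unfolding total_weight_def edge_weight_def by (intro sum_nonneg) simp
    ultimately have "exp (log_cost \<pi> m []) powr (1 / total_weight h) \<le>
        exp (log_cost \<rho> m []) powr (1 / total_weight h)"
      using opt by (intro powr_mono2) auto
    then show ?thesis
      using weighted_edge_product_eq[OF _ m] rec \<rho> by (simp add: recursive_layout_def)
  qed
  then show ?thesis
    using rec by (auto simp: is_arg_min_def not_less)
qed

end
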